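(* Let $\lambda\neq0$. For integers $n\ge0$ and $m\in\mathbb{N}$, \[ \frac{2^n}{n+1}\bigl(b_{n+1,\lambda}(m)-b_{n+1,\lambda}\bigr)=\sum_{l=0}^{m-1}(2l+1)_{n,2\lambda}. \]
   Context: $(x)_{0,\lambda}=1$, $(x)_{k,\lambda}=x(x-\lambda)\cdots(x-(k-1)\lambda)$ for $k\ge1$; $e_\lambda^x(t)=(1+\lambda t)^{x/\lambda}=\sum_{k\ge0}(x)_{k,\lambda}\frac{t^k}{k!}$. Degenerate Carlitz type 2 Bernoulli polynomials: $\frac{t}{e_\lambda^{1/2}(t)-e_\lambda^{-1/2}(t)}e_\lambda^x(t)=\sum_{n\ge0}b_{n,\lambda}(x)\frac{t^n}{n!}$ (formal power series in $t$), and $b_{n,\lambda}=b_{n,\lambda}(0)$. *)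

theory Defs
  imports "HOL-Computational_Algebra.Formal_Power_Series"
begin

definition degen_falling :: "'a::field_char_0 \<Rightarrow> nat \<Rightarrow> 'a \<Rightarrow> 'a"
  where "degen_falling x k lam = (\<Prod>i<k. x - of_nat i * lam)"

text \<open>The series \<open>(1 + \<lambda> t)\<^bsup>x/\<lambda>\<^esup>\<close>, i.e. the binomial series
  \<open>(1 + u)\<^bsup>x/\<lambda>\<^esup>\<close> at \<open>u = \<lambda> t\<close>; only meaningful for \<open>\<lambda> \<noteq> 0\<close>.\<close>

definition degen_exp :: "'a::field_char_0 \<Rightarrow> 'a \<Rightarrow> 'a fps"
  where "degen_exp lam x = fps_compose (fps_binomial (x / lam)) (fps_const lam * fps_X)"

lemma degen_exp_nth:
  assumes "lam \<noteq> 0"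
  shows "fps_nth (degen_exp lam x) k = degen_falling x k lam / fact k"
proof -
  have "lam ^ k * (\<Prod>i<k. x / lam - of_nat i) = (\<Prod>i<k. lam * (x / lam - of_nat i))"
    by (simp add: prod.distrib)
  also have "\<dots> = degen_falling x k lam"
    unfolding degen_falling_def using assms by (intro prod.cong) (auto simp: field_simps)
  finally show ?thesis
    by (simp add: degen_exp_def gbinomial_prod_rev fps_compose_linear atLeast0LessThan)
qed

text \<open>The denominator below has vanishing constant term, so it is not a unit. It has order
  exactly 1, however, so the division of power series is exact.\<close>

definition degen_carlitz_gf :: "'a::field_char_0 \<Rightarrow> 'a \<Rightarrow> 'a fps"
  where "degen_carlitz_gf lam x =
    fps_X / (degen_exp lam (1/2) - degen_exp lam (- (1/2))) * degen_exp lam x"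

lemma degen_carlitz_gf_mult:
  fixes lam x :: "'a::field_char_0"
  assumes "lam \<noteq> 0"
  shows "degen_carlitz_gf lam x * (degen_exp lam (1/2) - degen_exp lam (- (1/2)))
    = fps_X * degen_exp lam x"
proof -
  let ?D = "degen_exp lam (1/2) - degen_exp lam (- (1/2)) :: 'a fps"
  have D: "fps_nth ?D 0 = 0" "fps_nth ?D 1 = 1"
    using assms by (simp_all add: degen_exp_nth degen_falling_def)
  have "subdegree ?D = 1"
    using D by (intro subdegreeI) auto
  moreover have "?D \<noteq> 0" using D by (metis fps_zero_nth zero_neq_one)
  ultimately have "?D dvd fps_X"
    by (subst fps_dvd_iff) auto
  then have "fps_X / ?D * ?D = fps_X" by (rule dvd_div_mult_self)
  then show ?thesis
    unfolding degen_carlitz_gf_def by (metis mult.assoc mult.commute)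
qed

definition degen_carlitz_poly :: "nat \<Rightarrow> 'a::field_char_0 \<Rightarrow> 'a \<Rightarrow> 'a"
  where "degen_carlitz_poly n lam x = fact n * fps_nth (degen_carlitz_gf lam x) n"

definition degen_carlitz_number :: "nat \<Rightarrow> 'a::field_char_0 \<Rightarrow> 'a"
  where "degen_carlitz_number n lam = degen_carlitz_poly n lam 0"

end

theory Submission
  imports Defs
begin

text \<open>Since \<open>e\<^bsup>x+1\<^esup> - e\<^bsup>x\<^esup> = (e\<^bsup>1/2\<^esup> - e\<^bsup>-1/2\<^esup>) e\<^bsup>x+1/2\<^esup>\<close>, the denominator of the generating
  function cancels in its forward difference in \<open>x\<close>, which is therefore \<open>t e\<^bsup>x+1/2\<^esup>\<close>; the sum
  over \<open>l\<close> telescopes.\<close>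

lemma degen_exp_add: "degen_exp lam (x + y) = degen_exp lam x * degen_exp lam y"
  by (simp add: degen_exp_def add_divide_distrib fps_binomial_add_mult fps_compose_mult_distrib)

text \<open>Each of the \<open>n\<close> factors is homogeneous in \<open>x\<close> and
  \<open>lam\<close> jointly. With \<open>c = 2\<close> this absorbs the power \<open>2 ^ n\<close>
  and turns the half-integers l + 1/2 with step \<open>lam\<close> into the odd integers 2l + 1 with
  step \<open>2 * lam\<close>.\<close>

lemma degen_falling_scale: "degen_falling (c * x) n (c * lam) = c ^ n * degen_falling x n lam"
proof -
  have "degen_falling (c * x) n (c * lam) = (\<Prod>i<n. c * (x - of_nat i * lam))"
    by (simp add: degen_falling_def algebra_simps)
  then show ?thesis
    by (simp add: degen_falling_def prod.distrib)
qed

lemma degen_carlitz_gf_diff: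
  fixes lam x :: "'a::field_char_0"
  assumes "lam \<noteq> 0"
  shows "degen_carlitz_gf lam (x + 1) - degen_carlitz_gf lam x = fps_X * degen_exp lam (x + 1/2)"
proof -
  let ?D = "degen_exp lam (1/2) - degen_exp lam (- (1/2)) :: 'a fps"
  \<comment> \<open>The linear coefficient of \<open>?D\<close> is 1/2 - (-1/2) = 1, so
    \<open>?D\<close> is nonzero and can be cancelled at the end.\<close>
  have "fps_nth ?D 1 = 1"
    using assms by (simp add: degen_exp_nth degen_falling_def)
  then have "?D \<noteq> 0"
    by (metis fps_zero_nth zero_neq_one)
  have "degen_exp lam (x + 1/2) * ?D = degen_exp lam (x + 1) - degen_exp lam x"
    by (simp add: right_diff_distrib add.commute flip: degen_exp_add)
  then have "fps_X * degen_exp lam (x + 1/2) * ?D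
      = fps_X * degen_exp lam (x + 1) - fps_X * degen_exp lam x"
    by (metis mult.assoc right_diff_distrib)
  also have "\<dots> = (degen_carlitz_gf lam (x + 1) - degen_carlitz_gf lam x) * ?D"
    by (simp only: left_diff_distrib flip: degen_carlitz_gf_mult[OF assms])
  finally show ?thesis
    using \<open>?D \<noteq> 0\<close> by (metis mult_right_cancel)
qed

lemma degen_carlitz_poly_diff:
  fixes lam x :: "'a::field_char_0"
  assumes "lam \<noteq> 0"
  shows "degen_carlitz_poly (Suc n) lam (x + 1) - degen_carlitz_poly (Suc n) lam x
    = of_nat (Suc n) * degen_falling (x + 1/2) n lam"
proof -
  have "degen_carlitz_poly (Suc n) lam (x + 1) - degen_carlitz_poly (Suc n) lam x
      = fact (Suc n) * fps_nth (degen_carlitz_gf lam (x + 1) - degen_carlitz_gf lam x) (Suc n)"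
    by (simp only: degen_carlitz_poly_def right_diff_distrib fps_sub_nth)
  \<comment> \<open>The factor \<open>fps_X\<close> lowers the index from \<open>Suc n\<close> to
    \<open>n\<close>; the mismatch of the factorials leaves the factor \<open>Suc n\<close>.\<close>
  also have "\<dots> = fact (Suc n) * (degen_falling (x + 1/2) n lam / fact n)"
    by (simp only: degen_carlitz_gf_diff[OF assms] fps_X_mult_nth
        degen_exp_nth[OF assms]) simp
  finally show ?thesis
    by simp
qed

theorem theorem2p9:
  fixes lam :: "'a::field_char_0" and n m :: nat
  assumes "lam \<noteq> 0"
  shows "2 ^ n / of_nat (n + 1) *
      (degen_carlitz_poly (n + 1) lam (of_nat m) - degen_carlitz_number (n + 1) lam)
    = (\<Sum>l<m. degen_falling (of_nat (2 * l + 1)) n (2 * lam))"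
proof -
  have "degen_carlitz_poly (n + 1) lam (of_nat m) - degen_carlitz_number (n + 1) lam
      = (\<Sum>l<m. degen_carlitz_poly (Suc n) lam (of_nat (Suc l)) - degen_carlitz_poly (Suc n) lam (of_nat l))"
    by (subst sum_lessThan_telescope) (simp add: degen_carlitz_number_def)
  also have "\<dots> = of_nat (Suc n) * (\<Sum>l<m. degen_falling (of_nat l + 1/2) n lam)"
    using degen_carlitz_poly_diff[OF assms, of n "of_nat _"]
    by (simp only: of_nat_Suc add.commute[of 1] sum_distrib_left)
  \<comment> \<open>The factor \<open>of_nat (Suc n)\<close> cancels the denominator, being nonzero
    in characteristic 0.\<close>
  finally have "2 ^ n / of_nat (n + 1) *
      (degen_carlitz_poly (n + 1) lam (of_nat m) - degen_carlitz_number (n + 1) lam)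
    = (\<Sum>l<m. 2 ^ n * degen_falling (of_nat l + 1/2) n lam)"
    by (simp add: sum_distrib_left del: of_nat_Suc)
  also have "\<dots> = (\<Sum>l<m. degen_falling (of_nat (2 * l + 1)) n (2 * lam))"
    by (simp add: distrib_left add.commute flip: degen_falling_scale)
  finally show ?thesis .
qed

end
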